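(* Let $F=f+h$ and the functions $\varphi_k$ be as in the context, with $\alpha_k\in(0,1)$ for all $k$. Then, for all $x\in\mathbb{R}^n$, $\varphi_k(x)\le F(x)$ for all $k\ge0$.
   Context: Setting: $F:=f+h$ on $\mathbb{R}^n$ (Euclidean norm), where $h:\mathbb{R}^n\to\mathbb{R}$ is convex (possibly nonsmooth) and $f:\mathbb{R}^n\to\mathbb{R}$ is continuously differentiable, $\mu$-strongly convex and $L$-smooth with $L\ge\mu>0$, i.e. for all $x,y\in\mathbb{R}^n$: $f(x)\ge f(y)+\langle\nabla f(y),x-y\rangle+\frac{\mu}{2}\|x-y\|^2$ and $f(x)\le f(y)+\langle\nabla f(y),x-y\rangle+\frac{L}{2}\|x-y\|^2$. Proximal gradient: $\mathrm{prox}_{h,L}(x):=\arg\min_u\{h(u)+\frac{L}{2}\|x-u\|^2\}$, $G_L(x):=L\left(x-\mathrm{prox}_{h,L}(x-\frac1L\nabla f(x))\right)$, and $x^+:=x-\frac1L G_L(x)$. For $x,y\in\mathbb{R}^n$ put $\varphi(x;y):=F(y^+)+\langle G_L(y),x-y\rangle+\frac{\mu}{2}\|x-y\|^2+\frac{1}{2L}\|G_L(y)\|^2$. Given a point $x_0\in\mathbb{R}^n$, arbitrary points $y_k\in\mathbb{R}^n$ and $\alpha_k\in(0,1)$ ($k\ge0$), define $\varphi_0(x):=\varphi(x;x_0)$ and recursively $\varphi_{k+1}(x):=(1-\alpha_k)\varphi_k(x)+\alpha_k\varphi(x;y_k)$. *)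

theory Defs
  imports "HOL-Analysis.Analysis"
begin

definition grad :: "('a::real_inner \<Rightarrow> real) \<Rightarrow> 'a \<Rightarrow> 'a" where
  "grad f x = (THE d. GDERIV f x :> d)"

text \<open>The first conjunct is differentiability of \<open>f\<close> everywhere: gradients are unique, so it
  holds as soon as every point has some gradient, and it fails if some point has none.\<close>

definition cont_differentiable :: "('a::real_inner \<Rightarrow> real) \<Rightarrow> bool" where
  "cont_differentiable f \<longleftrightarrow>
     (\<forall>x. GDERIV f x :> grad f x) \<and> continuous_on UNIV (grad f)"

definition strongly_convex :: "real \<Rightarrow> ('a::real_inner \<Rightarrow> real) \<Rightarrow> bool" where
  "strongly_convex \<mu> f \<longleftrightarrow>
     (\<forall>x y. f x \<ge> f y + inner (grad f y) (x - y) + \<mu> / 2 * (norm (x - y))\<^sup>2)"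

definition smooth :: "real \<Rightarrow> ('a::real_inner \<Rightarrow> real) \<Rightarrow> bool" where
  "smooth L f \<longleftrightarrow>
     (\<forall>x y. f x \<le> f y + inner (grad f y) (x - y) + L / 2 * (norm (x - y))\<^sup>2)"

text \<open>For convex \<open>h\<close> on a finite-dimensional space and \<open>L > 0\<close> the minimiser exists and is
  unique, so the choice made by \<open>ARG_MIN\<close> is determined.\<close>

definition prox :: "('a::real_inner \<Rightarrow> real) \<Rightarrow> real \<Rightarrow> 'a \<Rightarrow> 'a" where
  "prox h L x = (arg_min (\<lambda>u. h u + L / 2 * (norm (x - u))\<^sup>2) (\<lambda>u. True))"

definition grad_map ::
    "('a::real_inner \<Rightarrow> real) \<Rightarrow> ('a \<Rightarrow> real) \<Rightarrow> real \<Rightarrow> 'a \<Rightarrow> 'a" where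
  "grad_map f h L x = L *\<^sub>R (x - prox h L (x - (1 / L) *\<^sub>R grad f x))"

definition prox_step ::
    "('a::real_inner \<Rightarrow> real) \<Rightarrow> ('a \<Rightarrow> real) \<Rightarrow> real \<Rightarrow> 'a \<Rightarrow> 'a" where
  "prox_step f h L x = x - (1 / L) *\<^sub>R grad_map f h L x"

definition lower_model ::
    "('a::real_inner \<Rightarrow> real) \<Rightarrow> ('a \<Rightarrow> real) \<Rightarrow> real \<Rightarrow> real \<Rightarrow> 'a \<Rightarrow> 'a \<Rightarrow> real" where
  "lower_model f h \<mu> L x y =
     (f (prox_step f h L y) + h (prox_step f h L y))
     + inner (grad_map f h L y) (x - y)
     + \<mu> / 2 * (norm (x - y))\<^sup>2
     + 1 / (2 * L) * (norm (grad_map f h L y))\<^sup>2"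

primrec phi ::
    "('a::real_inner \<Rightarrow> real) \<Rightarrow> ('a \<Rightarrow> real) \<Rightarrow> real \<Rightarrow> real \<Rightarrow>
     'a \<Rightarrow> (nat \<Rightarrow> 'a) \<Rightarrow> (nat \<Rightarrow> real) \<Rightarrow> nat \<Rightarrow> 'a \<Rightarrow> real" where
  "phi f h \<mu> L x0 y \<alpha> 0 = (\<lambda>x. lower_model f h \<mu> L x x0)"
| "phi f h \<mu> L x0 y \<alpha> (Suc k) =
     (\<lambda>x. (1 - \<alpha> k) * phi f h \<mu> L x0 y \<alpha> k x + \<alpha> k * lower_model f h \<mu> L x (y k))"

end

theory Submission
  imports Defs
begin

text \<open>
  Each \<open>\<phi>\<^sub>k\<close> is a convex combination of the functions \<open>\<phi>(\<cdot>; y)\<close>, so it suffices that each of these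
  lies below \<open>F = f + h\<close> (\<open>lower_model_le\<close>). Write \<open>p = y\<^sup>+\<close>, \<open>G = G\<^sub>L(y) = L (y - p)\<close> and
  \<open>z = y - \<nabla>f(y) / L\<close>, so that \<open>p = prox\<^bsub>h,L\<^esub>(z)\<close>. Three inequalities are added up: strong convexity
  bounds \<open>f(x)\<close> from below by its expansion at \<open>y\<close>, smoothness bounds the value \<open>f(y)\<close> occurring
  there from below in terms of \<open>f(p)\<close>, and the optimality of \<open>p\<close> says that
  \<open>L (z - p) = G - \<nabla>f(y)\<close> is a subgradient of \<open>h\<close> at \<open>p\<close> (\<open>prox_subgradient\<close>). The terms with
  \<open>\<nabla>f(y)\<close> cancel, and \<open>x - p = (x - y) + G / L\<close> turns what remains into \<open>\<phi>(x; y)\<close>.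

  Optimality can be used only once the minimiser defining the proximal point is known to exist.
  A finite convex function on a Euclidean space is continuous and decreases at most linearly, so
  the quadratic term makes the objective coercive and compactness of balls gives a minimiser
  (\<open>prox_objective_attains_min\<close>).
\<close>

text \<open>Continuity gives a lower bound of \<open>h\<close> on the closed unit ball around \<open>z\<close>. By convexity,
  the slope of \<open>h\<close> from \<open>z\<close> to \<open>u\<close> is at least the slope up to the point where the ray leaves this ball.\<close>

lemma convex_linear_lower_bound:
  fixes h :: "'a::euclidean_space \<Rightarrow> real"
  assumes conv: "convex_on UNIV h"
  obtains c where "\<And>u. 1 \<le> norm (u - z) \<Longrightarrow> h z - c * norm (u - z) \<le> h u"
proof -
  have cont: "continuous_on UNIV h"
    using conv by (intro convex_on_continuous) auto
  obtain w where w: "\<And>v. v \<in> cball z 1 \<Longrightarrow> h w \<le> h v"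
    using continuous_attains_inf[of "cball z 1" h] continuous_on_subset[OF cont]
    by (metis cball_eq_empty compact_cball not_one_less_zero subset_UNIV)
  have "h z - (h z - h w) * norm (u - z) \<le> h u" if r: "1 \<le> norm (u - z)" for u
  proof -
    define r where "r = norm (u - z)"
    define v where "v = (1 - 1/r) *\<^sub>R z + (1/r) *\<^sub>R u"
    have "v - z = (1/r) *\<^sub>R (u - z)"
      by (simp add: v_def algebra_simps)
    hence "norm (v - z) = 1"
      using r by (auto simp: r_def)
    hence "h w \<le> h v"
      by (intro w) (simp add: dist_norm norm_minus_commute)
    also have "h v \<le> (1 - 1/r) * h z + (1/r) * h u"
      unfolding v_def using r[folded r_def] by (intro convex_onD[OF conv]) auto
    finally have "r * h w \<le> r * ((1 - 1/r) * h z + (1/r) * h u)"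
      using r by (intro mult_left_mono) (auto simp: r_def)
    also have "\<dots> = (r - 1) * h z + h u"
      using r unfolding r_def[symmetric] by (simp add: field_simps)
    finally show ?thesis
      by (simp add: r_def algebra_simps)
  qed
  thus thesis by (rule that)
qed

lemma prox_objective_attains_min:
  fixes h :: "'a::euclidean_space \<Rightarrow> real"
  assumes conv: "convex_on UNIV h" and L: "0 < L"
  shows "\<exists>p. \<forall>u. h p + L / 2 * (norm (z - p))\<^sup>2 \<le> h u + L / 2 * (norm (z - u))\<^sup>2"
proof -
  let ?q = "\<lambda>u. h u + L / 2 * (norm (z - u))\<^sup>2"
  obtain c where c: "\<And>u. 1 \<le> norm (u - z) \<Longrightarrow> h z - c * norm (u - z) \<le> h u"
    using convex_linear_lower_bound[OF conv] by blast
  \<comment> \<open>From this radius on, the quadratic term outweighs the linear decrease of \<open>h\<close>.\<close>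
  define R where "R = max 1 (2 * c / L)"
  have "continuous_on UNIV h"
    using conv by (intro convex_on_continuous) auto
  hence "continuous_on (cball z R) ?q"
    by (intro continuous_intros) (auto intro: continuous_on_subset)
  moreover have "cball z R \<noteq> {}"
    by (simp add: R_def)
  ultimately obtain p where p: "\<And>u. u \<in> cball z R \<Longrightarrow> ?q p \<le> ?q u"
    using continuous_attains_inf[OF compact_cball] by blast
  have "?q p \<le> ?q u" for u
  proof (cases "u \<in> cball z R")
    case False
    define r where "r = norm (u - z)"
    have r: "R < r"
      using False by (simp add: r_def dist_norm norm_minus_commute)
    have "2 * c / L \<le> r" and r1: "1 \<le> r"
      using r by (auto simp: R_def)
    hence "c \<le> L / 2 * r"
      using L by (simp add: field_simps)
    hence "c * r \<le> L / 2 * r * r"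
      using r1 by (intro mult_right_mono) auto
    hence "h z \<le> ?q u"
      using c[of u] r1 by (simp add: r_def norm_minus_commute power2_eq_square)
    moreover have "?q p \<le> h z"
      using p[of z] by (simp add: R_def)
    ultimately show ?thesis by linarith
  qed (rule p)
  thus ?thesis by blast
qed

lemma prox_le:
  fixes h :: "'a::euclidean_space \<Rightarrow> real"
  assumes "convex_on UNIV h" "0 < L"
  shows "h (prox h L z) + L / 2 * (norm (z - prox h L z))\<^sup>2 \<le> h u + L / 2 * (norm (z - u))\<^sup>2"
proof -
  let ?q = "\<lambda>u. h u + L / 2 * (norm (z - u))\<^sup>2"
  obtain p where "\<forall>u. ?q p \<le> ?q u"
    using prox_objective_attains_min[OF assms] by blast
  hence "is_arg_min ?q (\<lambda>u. True) p"
    by (auto simp: is_arg_min_linorder)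
  hence "is_arg_min ?q (\<lambda>u. True) (prox h L z)"
    unfolding prox_def arg_min_def by (rule someI)
  thus ?thesis
    by (auto simp: is_arg_min_linorder)
qed

text \<open>Compare the minimiser \<open>p\<close> with \<open>p + t (x - p)\<close>: after division by \<open>t\<close>, convexity of \<open>h\<close>
  leaves the claimed inequality up to an error of order \<open>t\<close>, which vanishes as \<open>t\<close> tends to 0.\<close>

lemma prox_subgradient:
  fixes h :: "'a::euclidean_space \<Rightarrow> real"
  assumes conv: "convex_on UNIV h" and L: "0 < L"
  shows "h (prox h L z) + L * inner (z - prox h L z) (x - prox h L z) \<le> h x"
proof -
  define p where "p = prox h L z"
  define i where "i = inner (z - p) (x - p)"
  define s where "s = h x - h p - L * i"
  define d where "d = L / 2 * (norm (x - p))\<^sup>2"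
  have "- (t * d) \<le> s" if t: "0 < t" "t < 1" for t
  proof -
    define v where "v = (1 - t) *\<^sub>R p + t *\<^sub>R x"
    have zv: "z - v = (z - p) - t *\<^sub>R (x - p)"
      by (simp add: v_def algebra_simps)
    have "h p + L / 2 * (norm (z - p))\<^sup>2 \<le> h v + L / 2 * (norm (z - v))\<^sup>2"
      unfolding p_def by (rule prox_le[OF assms])
    moreover have "h v \<le> (1 - t) * h p + t * h x"
      unfolding v_def using t by (intro convex_onD[OF conv]) auto
    moreover have sq: "(norm (z - v))\<^sup>2 = (norm (z - p))\<^sup>2 - 2 * t * i + t\<^sup>2 * (norm (x - p))\<^sup>2"
      unfolding zv i_def power2_norm_eq_inner
      by (simp add: inner_diff inner_commute power2_eq_square algebra_simps)
    moreover have "L / 2 * (norm (z - v))\<^sup>2 = L / 2 * (norm (z - p))\<^sup>2 - t * (L * i) + t * (t * d)"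
      unfolding sq by (simp add: d_def power2_eq_square field_simps)
    moreover have "t * (s + t * d) = t * h x - t * h p - t * (L * i) + t * (t * d)"
      by (simp add: s_def algebra_simps)
    moreover have "(1 - t) * h p = h p - t * h p"
      by (simp add: algebra_simps)
    ultimately have "0 \<le> t * (s + t * d)"
      by linarith
    thus ?thesis
      using t by (simp add: zero_le_mult_iff)
  qed
  hence "\<forall>\<^sub>F t in at_right 0. - (t * d) \<le> s"
    by (auto simp: eventually_at_right_field intro!: exI[of _ 1])
  moreover have "((\<lambda>t. - (t * d)) \<longlongrightarrow> - (0 * d)) (at_right 0)"
    by (intro tendsto_intros)
  ultimately have "- (0 * d) \<le> s"
    by (intro tendsto_upperbound) auto
  thus ?thesis
    by (simp add: s_def i_def p_def)
qed

lemma lower_model_le: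
  fixes f h :: "'a::euclidean_space \<Rightarrow> real"
  assumes conv: "convex_on UNIV h" and L: "0 < L"
    and sc: "strongly_convex \<mu> f" and sm: "smooth L f"
  shows "lower_model f h \<mu> L x y \<le> f x + h x"
proof -
  define g where "g = grad f y"
  define G where "G = grad_map f h L y"
  define p where "p = prox_step f h L y"
  define z where "z = y - (1 / L) *\<^sub>R g"
  have p_prox: "p = prox h L z"
    using L by (simp add: p_def prox_step_def grad_map_def z_def g_def)
  have py: "p = y - (1 / L) *\<^sub>R G"
    by (simp add: p_def prox_step_def G_def)
  have zp: "L *\<^sub>R (z - p) = G - g"
    using L by (simp add: z_def py algebra_simps)
  have "h p + inner (L *\<^sub>R (z - p)) (x - p) \<le> h x"
    using prox_subgradient[OF conv L, of z x] by (simp add: p_prox)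
  hence "h p + inner (G - g) (x - p) \<le> h x"
    by (simp only: zp)
  moreover have "f y + inner g (x - y) + \<mu> / 2 * (norm (x - y))\<^sup>2 \<le> f x"
    using sc by (simp add: strongly_convex_def g_def)
  moreover have "f p \<le> f y + inner g (p - y) + L / 2 * (norm (p - y))\<^sup>2"
    using sm by (simp add: smooth_def g_def)
  moreover have "L / 2 * (norm (p - y))\<^sup>2 = 1 / (2 * L) * (norm G)\<^sup>2"
    using L by (simp add: py power_mult_distrib power_divide power2_eq_square)
  moreover have "inner (G - g) (x - p) = inner G (x - p) - inner g (x - y) + inner g (p - y)"
    by (simp add: inner_diff)
  moreover have "inner G (x - p) = inner G (x - y) + 2 * (1 / (2 * L) * (norm G)\<^sup>2)"
    by (simp add: py inner_diff power2_norm_eq_inner)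
  ultimately have "f p + h p + inner G (x - y) + \<mu> / 2 * (norm (x - y))\<^sup>2
      + 1 / (2 * L) * (norm G)\<^sup>2 \<le> f x + h x"
    by linarith
  thus ?thesis
    by (simp add: lower_model_def p_def G_def)
qed

theorem lemma6:
  fixes f h :: "real ^ 'n \<Rightarrow> real"
    and \<mu> L :: real
    and x0 :: "real ^ 'n"
    and y :: "nat \<Rightarrow> real ^ 'n"
    and \<alpha> :: "nat \<Rightarrow> real"
  assumes "convex_on UNIV h"
    and "cont_differentiable f"
    and "0 < \<mu>" and "\<mu> \<le> L"
    and "strongly_convex \<mu> f"
    and "smooth L f"
    and "\<And>k. 0 < \<alpha> k \<and> \<alpha> k < 1"
  shows "\<forall>x. \<forall>k. phi f h \<mu> L x0 y \<alpha> k x \<le> f x + h x"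
proof (intro allI)
  fix x k
  have "0 < L"
    using assms(3,4) by linarith
  hence model: "lower_model f h \<mu> L x v \<le> f x + h x" for v
    using assms by (intro lower_model_le)
  show "phi f h \<mu> L x0 y \<alpha> k x \<le> f x + h x"
  proof (induction k)
    case 0
    show ?case by (simp add: model)
  next
    case (Suc k)
    show ?case
      using convex_bound_le[OF Suc model[of "y k"], of "1 - \<alpha> k" "\<alpha> k"] assms(7)[of k] by simp
  qed
qed

end
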